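(* Let $S$ be a semigroup, let $F$ be a field with $\mathrm{char}(F)\neq 2$, let $\sigma:S\to S$ be an involutive anti-automorphism, and let $\beta\in F\setminus\{0\}$ and $\gamma\in F$. Suppose $f,g:S\to F$ are linearly independent and satisfy \[ f(x\sigma(y))=f(x)g(y)+\beta\,g(x)f(y)+\gamma\,f(x)f(y)\qquad\text{for all }x,y\in S. \] Assume that there exists a central element $c\in Z(S)$ such that $f(c)\neq 0$. Then the following hold. (i) If $\beta=-1$, then $\gamma=0$. Furthermore, there exists $a\in F$ such that \[ f(xy)=f(x)g(y)+g(x)f(y)+a\,f(x)f(y)\qquad\text{for all }x,y\in S, \] and \[ f\circ\sigma=-f,\qquad g\circ\sigma=g+af. \] (ii) If $\beta\neq -1$, then necessarily $\beta=1$, and \[ f(xy)=f(x)g(y)+g(x)f(y)+\gamma\,f(x)f(y)\qquad\text{for all }x,y\in S, \] and \[ f\circ\sigma=f,\qquad g\circ\sigma=g. \]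
   Context: An involutive anti-automorphism of $S$ is a bijective map $\sigma:S\to S$ with $\sigma(xy)=\sigma(y)\sigma(x)$ for all $x,y\in S$ and $\sigma^2=\mathrm{id}$. $Z(S)=\{c\in S: cx=xc\text{ for all }x\in S\}$ is the center of $S$. Linear independence is over $F$ in the vector space of all functions $S\to F$. *)

theory Defs
  imports
    Complex_Main
    "HOL-Library.Function_Algebras"
begin

definition involutive_anti_automorphism :: "('s::semigroup_mult \<Rightarrow> 's) \<Rightarrow> bool" where
  "involutive_anti_automorphism \<sigma> \<longleftrightarrow>
     bij \<sigma> \<and> (\<forall>x y. \<sigma> (x * y) = \<sigma> y * \<sigma> x) \<and> \<sigma> \<circ> \<sigma> = id"

definition semigroup_center :: "'s::semigroup_mult set" where
  "semigroup_center = {c. \<forall>x. c * x = x * c}"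

definition fun_scale :: "'f::field \<Rightarrow> ('s \<Rightarrow> 'f) \<Rightarrow> 's \<Rightarrow> 'f" where
  "fun_scale a h = (\<lambda>x. a * h x)"

interpretation fun_space: vector_space "fun_scale :: 'f::field \<Rightarrow> ('s \<Rightarrow> 'f) \<Rightarrow> 's \<Rightarrow> 'f"
  by unfold_locales (simp_all add: fun_scale_def fun_eq_iff algebra_simps)

(* fun_space.independent is a property of a set, so distinctness of the two vectors has to be
   required separately: otherwise the pair (f, f) with f nonzero would count as independent. *)
definition lin_indep_pair :: "('s \<Rightarrow> 'f::field) \<Rightarrow> ('s \<Rightarrow> 'f) \<Rightarrow> bool" where
  "lin_indep_pair f g \<longleftrightarrow> f \<noteq> g \<and> fun_space.independent {f, g}"

lemma lin_indep_pair_iff: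
  "lin_indep_pair f g \<longleftrightarrow> (\<forall>a b. (\<forall>x. a * f x + b * g x = 0) \<longrightarrow> a = 0 \<and> b = 0)"
proof (cases "f = g")
  case True
  have "(\<forall>x. 1 * g x + (- 1) * g x = 0) \<and> \<not> ((1::'b) = 0 \<and> (- 1::'b) = 0)" by simp
  with True show ?thesis unfolding lin_indep_pair_def by blast
next
  case False
  have eq: "(\<Sum>v\<in>{f, g}. fun_scale (u v) v) = 0 \<longleftrightarrow> (\<forall>x. u f * f x + u g * g x = 0)" for u
    using False by (simp add: fun_scale_def fun_eq_iff)
  have "fun_space.dependent {f, g} \<longleftrightarrow>
      (\<exists>u. (u f \<noteq> 0 \<or> u g \<noteq> 0) \<and> (\<forall>x. u f * f x + u g * g x = 0))"
    by (subst fun_space.dependent_finite) (auto simp: eq)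
  also have "\<dots> \<longleftrightarrow> (\<exists>a b. (a \<noteq> 0 \<or> b \<noteq> 0) \<and> (\<forall>x. a * f x + b * g x = 0))" (is "?L \<longleftrightarrow> ?R")
  proof
    assume ?R
    then obtain a b where ab: "a \<noteq> 0 \<or> b \<noteq> 0" "\<forall>x. a * f x + b * g x = 0" by blast
    show ?L
      by (rule exI[of _ "\<lambda>v. if v = f then a else b"]) (use ab False in auto)
  qed blast
  finally show ?thesis using False unfolding lin_indep_pair_def by blast
qed

end

theory Submission
  imports Defs
begin

text \<open>
  Replacing \<open>y\<close> by \<open>\<sigma> y\<close> turns the equation into a sine-type law \<open>f (x y) = f x * h y + g x * k y\<close>
  with \<open>k = \<beta> (f \<circ> \<sigma>)\<close>.  Associativity and the independence of \<open>f, g\<close> force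
  \<open>k (y z) = k y * h z + M y * k z\<close> for some \<open>M\<close>, while the original equation applied to
  \<open>\<sigma> (y z) = \<sigma> z * \<sigma> y\<close> expands the same value differently; comparing coefficients of the
  independent pair \<open>f \<circ> \<sigma>, g \<circ> \<sigma>\<close> gives \<open>f \<circ> \<sigma> = \<beta> f\<close>, hence \<open>\<beta>\<^sup>2 = 1\<close>.  Centrality of \<open>c\<close> then
  gives \<open>h = g + a f\<close>, and \<open>\<sigma>\<^sup>2 = id\<close> (for \<open>\<beta> = 1\<close>) or applying \<open>\<sigma>\<close> to the resulting addition
  law (for \<open>\<beta> = -1\<close>) fixes \<open>a\<close>.
\<close>

text \<open>Expanding \<open>f (x * y * z)\<close> in both groupings and solving at
  \<open>z = w\<close> writes \<open>g (x * y)\<close> as a combination of \<open>f x\<close> and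
  \<open>g x\<close>. Substituted back, this leaves a relation in \<open>x\<close> whose
  \<open>g\<close>-coefficient must vanish.\<close>

lemma sine_type_law_right_factor:
  fixes f g h k :: "'s::semigroup_mult \<Rightarrow> 'f::field"
  assumes ind: "lin_indep_pair f g"
    and law: "\<And>x y. f (x * y) = f x * h y + g x * k y"
    and nz: "k w \<noteq> 0"
  obtains M where "\<And>y z. k (y * z) = k y * h z + M y * k z"
proof -
  define L where "L y = (h (y * w) - h y * h w) / k w" for y
  define M where "M y = (k (y * w) - k y * h w) / k w" for y
  have assoc: "(f x * h y + g x * k y) * h z + g (x * y) * k z = f x * h (y * z) + g x * k (y * z)"
    for x y z
    using law[of "x * y" z] law[of x y] law[of x "y * z"] by (simp add: mult.assoc)
  have g_prod: "g (x * y) = f x * L y + g x * M y" for x y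
  proof -
    have "k w * L y = h (y * w) - h y * h w" "k w * M y = k (y * w) - k y * h w"
      using nz by (simp_all add: L_def M_def)
    moreover have "k w * g (x * y) = f x * (h (y * w) - h y * h w) + g x * (k (y * w) - k y * h w)"
      using assoc[of x y w] by (simp add: algebra_simps)
    ultimately have "k w * g (x * y) = k w * (f x * L y + g x * M y)"
      by (simp add: distrib_left mult.left_commute)
    then show ?thesis using nz by simp
  qed
  have "k (y * z) = k y * h z + M y * k z" for y z
  proof -
    have "(h y * h z + L y * k z - h (y * z)) * f x + (k y * h z + M y * k z - k (y * z)) * g x = 0"
      for x
      using assoc[of x y z] unfolding g_prod by (simp add: algebra_simps)
    with ind have "k y * h z + M y * k z - k (y * z) = 0"
      unfolding lin_indep_pair_iff by blast
    then show ?thesis by simp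
  qed
  then show thesis by (rule that)
qed

lemma sine_type_law_anti_automorphism:
  fixes f g :: "'s::semigroup_mult \<Rightarrow> 'f::field"
  assumes ind: "lin_indep_pair f g"
    and anti: "\<And>x y. \<sigma> (x * y) = \<sigma> y * \<sigma> x"
    and invol: "\<And>x. \<sigma> (\<sigma> x) = x"
    and \<beta>: "\<beta> \<noteq> 0"
    and eq: "\<And>x y. f (x * \<sigma> y) = f x * g y + \<beta> * (g x * f y) + \<gamma> * (f x * f y)"
    and nz: "f c \<noteq> 0"
  shows "f (\<sigma> y) = \<beta> * f y"
proof -
  define h where "h y = g (\<sigma> y) + \<gamma> * f (\<sigma> y)" for y
  define k where "k y = \<beta> * f (\<sigma> y)" for y
  have law: "f (x * y) = f x * h y + g x * k y" for x y
    using eq[of x "\<sigma> y"] unfolding invol h_def k_def by (simp add: algebra_simps)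
  have "k (\<sigma> c) \<noteq> 0" using \<beta> nz by (simp add: k_def invol)
  then obtain M where M: "\<And>y z. k (y * z) = k y * h z + M y * k z"
    using sine_type_law_right_factor[of f g h k, OF ind law] by blast
  \<comment> \<open>Expanding \<open>k (y * \<sigma> z)\<close> rather than \<open>k (y * z)\<close>
    yields \<open>f\<close> and \<open>g\<close> themselves at \<open>z\<close>, so
    \<open>ind\<close> applies directly.\<close>
  have "(g y + \<gamma> * f y - M y - \<gamma> * f (\<sigma> y)) * f z + (\<beta> * f y - f (\<sigma> y)) * g z = 0" for z
  proof -
    have "k (y * \<sigma> z) = \<beta> * (f z * g y + \<beta> * (g z * f y) + \<gamma> * (f z * f y))"
      using eq[of z y] by (simp add: k_def anti invol)
    moreover have "k (y * \<sigma> z) = \<beta> * (f (\<sigma> y) * (g z + \<gamma> * f z) + M y * f z)"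
      unfolding M by (simp add: h_def k_def invol algebra_simps)
    ultimately have "f z * g y + \<beta> * (g z * f y) + \<gamma> * (f z * f y)
        = f (\<sigma> y) * (g z + \<gamma> * f z) + M y * f z"
      using \<beta> by simp
    then show ?thesis by (simp add: algebra_simps)
  qed
  with ind have "\<beta> * f y - f (\<sigma> y) = 0"
    unfolding lin_indep_pair_iff by blast
  then show ?thesis by simp
qed

lemma two_neq_zero_if_CHAR_neq_2:
  assumes "CHAR('f::field) \<noteq> 2"
  shows "(2::'f) \<noteq> 0"
proof
  assume "(2::'f) = 0"
  then have "of_nat 2 = (0::'f)" by simp
  then have "CHAR('f) dvd 2" by (simp only: of_nat_eq_0_iff_char_dvd)
  moreover from this have "CHAR('f) \<le> 2" by (rule dvd_imp_le) simp
  moreover from \<open>CHAR('f) dvd 2\<close> have "CHAR('f) \<noteq> 0" by (metis dvd_0_left_iff zero_neq_numeral)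
  ultimately have "CHAR('f) = 1 \<or> CHAR('f) = 2" by linarith
  with assms show False by simp
qed

theorem corollary4p7:
  fixes \<sigma> :: "'s::semigroup_mult \<Rightarrow> 's"
    and f g :: "'s \<Rightarrow> 'f::field"
    and \<beta> \<gamma> :: 'f
  assumes "CHAR('f) \<noteq> 2"
    and "involutive_anti_automorphism \<sigma>"
    and "\<beta> \<noteq> 0"
    and "lin_indep_pair f g"
    and "\<forall>x y. f (x * \<sigma> y) = f x * g y + \<beta> * (g x * f y) + \<gamma> * (f x * f y)"
    and "\<exists>c \<in> semigroup_center. f c \<noteq> 0"
  shows "(\<beta> = -1 \<longrightarrow>
            \<gamma> = 0 \<and>
            (\<exists>a. (\<forall>x y. f (x * y) = f x * g y + g x * f y + a * (f x * f y)) \<and>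
                 (\<forall>x. f (\<sigma> x) = - f x) \<and>
                 (\<forall>x. g (\<sigma> x) = g x + a * f x)))
       \<and> (\<beta> \<noteq> -1 \<longrightarrow>
            \<beta> = 1 \<and>
            (\<forall>x y. f (x * y) = f x * g y + g x * f y + \<gamma> * (f x * f y)) \<and>
            f \<circ> \<sigma> = f \<and>
            g \<circ> \<sigma> = g)"
proof -
  have anti: "\<And>x y. \<sigma> (x * y) = \<sigma> y * \<sigma> x" and invol: "\<And>x. \<sigma> (\<sigma> x) = x"
    using assms(2) unfolding involutive_anti_automorphism_def fun_eq_iff by auto
  obtain c where comm: "\<And>x. c * x = x * c" and fc: "f c \<noteq> 0"
    using assms(6) unfolding semigroup_center_def by blast
  have eq: "\<And>x y. f (x * \<sigma> y) = f x * g y + \<beta> * (g x * f y) + \<gamma> * (f x * f y)"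
    using assms(5) by blast
  have two: "(2::'f) \<noteq> 0" using assms(1) by (rule two_neq_zero_if_CHAR_neq_2)
  have f\<sigma>: "f (\<sigma> x) = \<beta> * f x" for x
    by (rule sine_type_law_anti_automorphism[OF assms(4) anti invol assms(3) eq fc])
  have "\<beta> * \<beta> = 1"
    using f\<sigma>[of "\<sigma> c"] f\<sigma>[of c] fc by (simp add: invol)
  then have sq: "\<beta> * (\<beta> * t) = t" for t
    by (simp flip: mult.assoc)
  have \<beta>_cases: "\<beta> = 1 \<or> \<beta> = -1"
    using \<open>\<beta> * \<beta> = 1\<close> by (simp add: square_eq_1_iff)
  have law: "f (x * y) = f x * (g (\<sigma> y) + \<gamma> * (\<beta> * f y)) + g x * f y" for x y
    using eq[of x "\<sigma> y"] by (simp add: invol f\<sigma> sq algebra_simps)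
  \<comment> \<open>Solves \<open>f (c * x) = f (x * c)\<close>, expanded by \<open>law\<close>, for
    the cofactor of \<open>f\<close> in \<open>law\<close>.\<close>
  define a where "a = (g (\<sigma> c) + \<gamma> * (\<beta> * f c) - g c) / f c"
  have h_eq: "g (\<sigma> x) + \<gamma> * (\<beta> * f x) = g x + a * f x" for x
    using law[of c x] law[of x c] comm[of x] fc unfolding a_def by (simp add: field_simps)
  have add_law: "f (x * y) = f x * g y + g x * f y + a * (f x * f y)" for x y
    unfolding law h_eq by (simp add: algebra_simps)
  \<comment> \<open>The \<open>f\<close>-coefficient of \<open>g \<circ> \<sigma>\<close>; it
    remains to show \<open>b = a\<close> for \<open>\<beta> = -1\<close> and \<open>b = 0\<close>
    for \<open>\<beta> = 1\<close>.\<close>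
  define b where "b = a - \<gamma> * \<beta>"
  have g\<sigma>: "g (\<sigma> x) = g x + b * f x" for x
    using h_eq[of x] unfolding b_def by (simp add: algebra_simps)
  show ?thesis
  proof (intro conjI impI)
    assume \<beta>: "\<beta> = -1"
    \<comment> \<open>Expanding both sides by \<open>add_law\<close>, the terms in
      \<open>f c * g c\<close> cancel and only a multiple of \<open>a - b\<close> survives.\<close>
    have "f (\<sigma> (c * c)) = - f (c * c)" by (simp add: f\<sigma> \<beta>)
    then have "2 * (a - b) * (f c * f c) = 0"
      unfolding anti add_law by (simp add: f\<sigma> g\<sigma> \<beta> algebra_simps)
    then have "a = b" using two fc by simp
    then show "\<gamma> = 0" using \<beta> by (simp add: b_def)
    show "\<exists>a. (\<forall>x y. f (x * y) = f x * g y + g x * f y + a * (f x * f y)) \<and>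
        (\<forall>x. f (\<sigma> x) = - f x) \<and> (\<forall>x. g (\<sigma> x) = g x + a * f x)"
      using add_law f\<sigma> g\<sigma> \<beta> \<open>a = b\<close> by (intro exI[of _ a]) simp
  next
    assume "\<beta> \<noteq> -1"
    then show \<beta>: "\<beta> = 1" using \<beta>_cases by blast
    \<comment> \<open>Two applications of \<sigma> add \<open>b * f c\<close> twice to
      \<open>g c\<close>, yet return \<open>g c\<close>.\<close>
    have "2 * b * f c = 0"
      using g\<sigma>[of "\<sigma> c"] g\<sigma>[of c] by (simp add: invol f\<sigma> \<beta> algebra_simps)
    then have "b = 0" using two fc by simp
    then have "a = \<gamma>" by (simp add: b_def \<beta>)
    then show "\<forall>x y. f (x * y) = f x * g y + g x * f y + \<gamma> * (f x * f y)"
      using add_law by simp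
    show "f \<circ> \<sigma> = f" by (simp add: fun_eq_iff f\<sigma> \<beta>)
    show "g \<circ> \<sigma> = g" by (simp add: fun_eq_iff g\<sigma> \<open>b = 0\<close>)
  qed
qed

end
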